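(* Let $\mathbf X=\{(X_{n,1},\dots,X_{n,d})\}_{n\ge1}$ be a $d$-dimensional stationary sequence. Suppose that for each $\boldsymbol\nu\in(0,\infty)^d$ there exist levels $\tilde{\mathbf u}^{(\boldsymbol\nu)}$, and that $\mathbf X$ satisfies condition $\Delta(\tilde{\mathbf u}^{(\boldsymbol\nu)})$ for all such levels. If $\mathbf X$ has multivariate upcrossings index $\eta(\boldsymbol\nu)>0$, $\boldsymbol\nu\in(0,\infty)^d$, then, for all $\boldsymbol\nu\in(0,\infty)^d$ and all levels $\tilde{\mathbf u}^{(\boldsymbol\nu)}$, $$\sum_{k\ge1}k\,\overline\Pi_n^{(\boldsymbol\nu)}(k)\xrightarrow[n\to\infty]{}\frac1{\eta(\boldsymbol\nu)},$$ where $$\overline\Pi_n^{(\boldsymbol\nu)}(k)=P\Big(\sum_{i=1}^{r_n}\mathbf 1_{\bigcup_{j=1}^d\{X_{i,j}\le u_{n,j}^{(\nu_j)}<X_{i+1,j}\}}=k\ \Big|\ \sum_{i=1}^{r_n}\mathbf 1_{\bigcup_{j=1}^d\{X_{i,j}\le u_{n,j}^{(\nu_j)}<X_{i+1,j}\}}>0\Big),$$ $r_n=[n/k_n]$, and $\{k_n\}_{n\ge1}$ is a sequence of positive integers with $k_n\to\infty$, $k_nl_n/n\to0$ and $k_n\alpha_{n,l_n}\to0$ as $n\to\infty$, with $l_n$ and $\alpha_{n,l_n}$ as in condition $\Delta(\tilde{\mathbf u}^{(\boldsymbol\nu)})$.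
   Context: For $\boldsymbol\nu\in(0,\infty)^d$, "levels $\tilde{\mathbf u}^{(\boldsymbol\nu)}$" means a sequence $\mathbf u=\{(u_{n,1}^{(\nu_1)},\dots,u_{n,d}^{(\nu_d)})\}_{n\ge1}$ in $\mathbb R^d$ such that $nP(X_{1,j}\le u_{n,j}^{(\nu_j)}<X_{2,j})\to\nu_j$ as $n\to\infty$ for each $j=1,\dots,d$. Condition $\Delta(\mathbf u)$: there is a sequence of positive integers $l_n=o(n)$ with $\alpha_{n,l_n}\to0$ as $n\to\infty$, where $$\alpha_{n,l}=\sup\{|P(A\cap B)-P(A)P(B)|:\ A\in\mathcal B_1^k(\mathbf u),\ B\in\mathcal B_{k+l}^n(\mathbf u),\ 1\le k\le n-l\}$$ and $\mathcal B_i^j(\mathbf u)$ is the $\sigma$-field generated by the events $\{X_{s,k}\le u_{n,k}\}$, $k=1,\dots,d$, $i\le s\le j$. Given levels $\tilde{\mathbf u}^{(\boldsymbol\nu)}$, $\mathbf S_n^{(\boldsymbol\nu)}=(S_{n,1},\dots,S_{n,d})$ with $S_{n,j}(B)=\sum_{i=1}^n\mathbf 1_{\{X_{i,j}\le u_{n,j}^{(\nu_j)}<X_{i+1,j}\}}\delta_{i/n}(B)$, $B\subset[0,1]$, $\delta_a$ the unit mass at $a$. Definition (multivariate upcrossings index). $\mathbf X$ has multivariate upcrossings index $\eta(\boldsymbol\nu)$, $\boldsymbol\nu\in(0,\infty)^d$, if for each $\boldsymbol\nu\in(0,\infty)^d$ there exist levels $\tilde{\mathbf u}^{(\boldsymbol\nu)}$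 and, for all levels $\tilde{\mathbf u}^{(\boldsymbol\nu)}$, $$\lim_{n\to\infty}\exp\Big(-nP\Big(\bigcup_{j=1}^d\{X_{1,j}\le u_{n,j}^{(\nu_j)}<X_{2,j}\}\Big)\Big)=\varphi(\boldsymbol\nu)$$ and $$\lim_{n\to\infty}P(\mathbf S_n^{(\boldsymbol\nu)}([0,1])=\mathbf 0)=(\varphi(\boldsymbol\nu))^{\eta(\boldsymbol\nu)},\qquad 0\le\eta(\boldsymbol\nu)\le1,$$ where $\varphi(\boldsymbol\nu)$ and $\eta(\boldsymbol\nu)$ depend only on $\boldsymbol\nu$. $[x]$ denotes the integer part of $x$. *)

theory Defs
  imports "HOL-Probability.Probability" "HOL-Library.Landau_Symbols"
begin

text \<open>
  Sequences are indexed by \<open>n \<ge> 1\<close>; their values at index \<open>0\<close> play no role. The \<open>n\<close>-th term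
  of a sequence of levels \<open>u\<close> is the vector \<open>u n\<close>, with components \<open>u n $ j\<close>.
\<close>

definition stationary_seq :: "'a measure \<Rightarrow> (nat \<Rightarrow> 'a \<Rightarrow> real ^ 'd) \<Rightarrow> bool" where
  "stationary_seq M X \<longleftrightarrow>
     (\<forall>n\<ge>1. X n \<in> borel_measurable M) \<and>
     (\<forall>I h. finite I \<longrightarrow> I \<subseteq> {1..} \<longrightarrow>
        distr M (PiM I (\<lambda>_. borel)) (\<lambda>\<omega>. \<lambda>i\<in>I. X (i + h) \<omega>)
        = distr M (PiM I (\<lambda>_. borel)) (\<lambda>\<omega>. \<lambda>i\<in>I. X i \<omega>))"

definition upcrossing ::
    "'a measure \<Rightarrow> (nat \<Rightarrow> 'a \<Rightarrow> real ^ 'd) \<Rightarrow> real ^ 'd \<Rightarrow> nat \<Rightarrow> 'd \<Rightarrow> 'a set" where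
  "upcrossing M X v i j = {\<omega> \<in> space M. X i \<omega> $ j \<le> v $ j \<and> v $ j < X (i + 1) \<omega> $ j}"

definition is_levels ::
    "'a measure \<Rightarrow> (nat \<Rightarrow> 'a \<Rightarrow> real ^ 'd) \<Rightarrow> real ^ 'd \<Rightarrow> (nat \<Rightarrow> real ^ 'd) \<Rightarrow> bool" where
  "is_levels M X \<nu> u \<longleftrightarrow>
     (\<forall>j. (\<lambda>n. real n * measure M (upcrossing M X (u n) 1 j)) \<longlonglongrightarrow> \<nu> $ j)"

definition level_sigma ::
    "'a measure \<Rightarrow> (nat \<Rightarrow> 'a \<Rightarrow> real ^ 'd) \<Rightarrow> real ^ 'd \<Rightarrow> nat \<Rightarrow> nat \<Rightarrow> 'a set set" where
  "level_sigma M X v i j =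
     sigma_sets (space M) {{\<omega> \<in> space M. X s \<omega> $ k \<le> v $ k} | s k. i \<le> s \<and> s \<le> j}"

text \<open>
  The supremum ranges over a set bounded by \<open>1\<close>, which is empty (so that the value is unspecified)
  only if \<open>l \<ge> n\<close>. For \<open>l = l n\<close> with \<open>l n = o(n)\<close> this concerns finitely many \<open>n\<close>, which do not
  affect the limits below.
\<close>

definition mixing_coeff ::
    "'a measure \<Rightarrow> (nat \<Rightarrow> 'a \<Rightarrow> real ^ 'd) \<Rightarrow> (nat \<Rightarrow> real ^ 'd) \<Rightarrow> nat \<Rightarrow> nat \<Rightarrow> real" where
  "mixing_coeff M X u n l =
     Sup {\<bar>measure M (A \<inter> B) - measure M A * measure M B\<bar> | A B k.
            A \<in> level_sigma M X (u n) 1 k \<and> B \<in> level_sigma M X (u n) (k + l) n \<and>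
            1 \<le> k \<and> k + l \<le> n}"

definition Delta_gap ::
    "'a measure \<Rightarrow> (nat \<Rightarrow> 'a \<Rightarrow> real ^ 'd) \<Rightarrow> (nat \<Rightarrow> real ^ 'd) \<Rightarrow> (nat \<Rightarrow> nat) \<Rightarrow> bool" where
  "Delta_gap M X u l \<longleftrightarrow>
     (\<forall>n\<ge>1. 0 < l n) \<and> (\<lambda>n. real (l n)) \<in> o(\<lambda>n. real n) \<and>
     (\<lambda>n. mixing_coeff M X u n (l n)) \<longlonglongrightarrow> 0"

definition condition_Delta ::
    "'a measure \<Rightarrow> (nat \<Rightarrow> 'a \<Rightarrow> real ^ 'd) \<Rightarrow> (nat \<Rightarrow> real ^ 'd) \<Rightarrow> bool" where
  "condition_Delta M X u \<longleftrightarrow> (\<exists>l. Delta_gap M X u l)"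

text \<open>The unit mass at \<open>a\<close>, evaluated at \<open>B\<close>, is written \<open>indicator B a\<close>.\<close>

definition upcrossings_process ::
    "'a measure \<Rightarrow> (nat \<Rightarrow> 'a \<Rightarrow> real ^ 'd) \<Rightarrow> (nat \<Rightarrow> real ^ 'd) \<Rightarrow> nat \<Rightarrow> 'a \<Rightarrow> real set \<Rightarrow> real ^ 'd"
  where
  "upcrossings_process M X u n \<omega> B =
     (\<chi> j. \<Sum>i=1..n. indicator (upcrossing M X (u n) i j) \<omega> * indicator B (real i / real n))"

definition multivariate_upcrossings_index ::
    "'a measure \<Rightarrow> (nat \<Rightarrow> 'a \<Rightarrow> real ^ 'd) \<Rightarrow> (real ^ 'd \<Rightarrow> real) \<Rightarrow> bool" where
  "multivariate_upcrossings_index M X \<eta> \<longleftrightarrow>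
     (\<exists>\<phi>. \<forall>\<nu>. (\<forall>j. 0 < \<nu> $ j) \<longrightarrow>
        (\<exists>u. is_levels M X \<nu> u) \<and>
        0 \<le> \<eta> \<nu> \<and> \<eta> \<nu> \<le> 1 \<and>
        (\<forall>u. is_levels M X \<nu> u \<longrightarrow>
           (\<lambda>n. exp (- (real n * measure M (\<Union>j. upcrossing M X (u n) 1 j)))) \<longlonglongrightarrow> \<phi> \<nu> \<and>
           (\<lambda>n. \<P>(\<omega> in M. upcrossings_process M X u n \<omega> {0..1} = 0)) \<longlonglongrightarrow> \<phi> \<nu> powr \<eta> \<nu>))"

definition upcrossings_count ::
    "'a measure \<Rightarrow> (nat \<Rightarrow> 'a \<Rightarrow> real ^ 'd) \<Rightarrow> real ^ 'd \<Rightarrow> nat \<Rightarrow> 'a \<Rightarrow> nat" where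
  "upcrossings_count M X v m \<omega> = (\<Sum>i=1..m. indicator (\<Union>j. upcrossing M X v i j) \<omega>)"

text \<open>The cluster size distribution for the block length \<open>r\<close>.\<close>

definition cluster_prob ::
    "'a measure \<Rightarrow> (nat \<Rightarrow> 'a \<Rightarrow> real ^ 'd) \<Rightarrow> (nat \<Rightarrow> real ^ 'd) \<Rightarrow> (nat \<Rightarrow> nat) \<Rightarrow> nat \<Rightarrow> nat \<Rightarrow> real"
  where
  "cluster_prob M X u r n k =
     \<P>(\<omega> in M. upcrossings_count M X (u n) (r n) \<omega> = k \<bar> upcrossings_count M X (u n) (r n) \<omega> > 0)"

end

theory Submission
  imports Defs
begin

text \<open>
  The mean cluster size is the conditional expectation of the number \<open>N\<close> of upcrossings in a block
  of length \<open>r = n div k\<close> given \<open>N > 0\<close>, which by stationarity equals \<open>r w / P(N > 0)\<close>, where \<open>w\<close>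
  is the probability of an upcrossing at one place. As \<open>k r \<sim> n\<close>, we have
  \<open>k r w \<rightarrow> \<tau> = - ln \<phi>(\<nu>)\<close>. By the mixing condition the probability of no upcrossing up to \<open>n\<close> is
  asymptotically \<open>P(N = 0)\<^sup>k\<close>, so that \<open>P(N = 0)\<^sup>k \<rightarrow> \<phi>(\<nu>) powr \<eta>(\<nu>) = exp (- \<eta>(\<nu>) \<tau>)\<close> and
  therefore \<open>k P(N > 0) \<rightarrow> \<eta>(\<nu>) \<tau>\<close>. Here \<open>\<tau> > 0\<close>, and the quotient tends to \<open>1 / \<eta>(\<nu>)\<close>.
\<close>

section \<open>Blocks without upcrossings: measurability and shift invariance\<close>

text \<open>The range of positions is open at \<open>h\<close>, so that blocks of length
  \<open>r\<close> placed at \<open>h = i * r\<close> for \<open>i = 0, 1, ...\<close> tile the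
  positive integers.\<close>

definition no_upcrossing ::
    "'a measure \<Rightarrow> (nat \<Rightarrow> 'a \<Rightarrow> real ^ 'd) \<Rightarrow> real ^ 'd \<Rightarrow> nat \<Rightarrow> nat \<Rightarrow> 'a set" where
  "no_upcrossing M X v h m =
     {\<omega> \<in> space M. \<forall>i\<in>{h<..h + m}. \<omega> \<notin> (\<Union>j. upcrossing M X v i j)}"

text \<open>An upcrossing at \<open>i\<close> also looks at \<open>X (i + 1)\<close>, so a block
  whose last position is \<open>h + m\<close> needs the indices up to \<open>h + m + 1\<close>. The
  condition that \<open>X (i + 1)\<close> exceeds the level is the complement of a generating
  event.\<close>

lemma no_upcrossing_in_level_sigma:
  assumes "a \<le> h + 1" "h + m + 1 \<le> b"
  shows "no_upcrossing M X v h m \<in> level_sigma M X v a b"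
proof -
  interpret L: sigma_algebra "space M" "level_sigma M X v a b"
    unfolding level_sigma_def by (rule sigma_algebra_sigma_sets) auto
  have basic: "{\<omega> \<in> space M. X s \<omega> $ j \<le> v $ j} \<in> level_sigma M X v a b"
    if "a \<le> s" "s \<le> b" for s j
    using that unfolding level_sigma_def by (intro sigma_sets.Basic) auto
  have "{\<omega> \<in> space M. \<forall>i\<in>{h<..h + m}. \<forall>j\<in>UNIV. \<not> (X i \<omega> $ j \<le> v $ j \<and> \<not> X (i + 1) \<omega> $ j \<le> v $ j)}
      \<in> level_sigma M X v a b"
    using assms
    by (intro L.sets_Collect_finite_All L.sets_Collect_neg L.sets_Collect_conj basic) auto
  also have "{\<omega> \<in> space M. \<forall>i\<in>{h<..h + m}. \<forall>j\<in>UNIV.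
      \<not> (X i \<omega> $ j \<le> v $ j \<and> \<not> X (i + 1) \<omega> $ j \<le> v $ j)} = no_upcrossing M X v h m"
    by (auto simp: no_upcrossing_def upcrossing_def not_le)
  finally show ?thesis .
qed

lemma stationary_seq_measurable:
  "stationary_seq M X \<Longrightarrow> 1 \<le> n \<Longrightarrow> X n \<in> borel_measurable M"
  by (auto simp: stationary_seq_def)

lemma level_sigma_subset_sets:
  assumes "stationary_seq M X" "1 \<le> a"
  shows "level_sigma M X v a b \<subseteq> sets M"
  unfolding level_sigma_def
proof (rule sets.sigma_sets_subset)
  have "{\<omega> \<in> space M. X s \<omega> $ k \<le> v $ k} \<in> sets M" if "a \<le> s" for s k
  proof -
    have [measurable]: "X s \<in> borel_measurable M"
      using assms that by (intro stationary_seq_measurable) auto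
    show ?thesis by measurable
  qed
  then show "{{\<omega> \<in> space M. X s \<omega> $ k \<le> v $ k} |s k. a \<le> s \<and> s \<le> b} \<subseteq> sets M"
    by auto
qed

lemma no_upcrossing_sets:
  assumes "stationary_seq M X"
  shows "no_upcrossing M X v h m \<in> sets M"
  using level_sigma_subset_sets[OF assms, of 1]
    no_upcrossing_in_level_sigma[of 1 h m "h + m + 1" M X v] by auto

lemma upcrossing_sets:
  assumes "stationary_seq M X" "1 \<le> i"
  shows "upcrossing M X v i j \<in> sets M"
proof -
  have [measurable]: "X i \<in> borel_measurable M" "X (i + 1) \<in> borel_measurable M"
    using assms by (auto intro!: stationary_seq_measurable)
  show ?thesis unfolding upcrossing_def by measurable
qed

lemma any_upcrossing_sets:
  fixes X :: "nat \<Rightarrow> 'a \<Rightarrow> real ^ 'd"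
  assumes "stationary_seq M X" "1 \<le> i"
  shows "(\<Union>j. upcrossing M X v i j) \<in> sets M"
  using upcrossing_sets[OF assms] by (intro sets.finite_UN) auto

text \<open>For every shift the event is the preimage of one set \<open>S\<close> of paths with
  \<open>m + 1\<close> coordinates, and stationarity gives the shifted and the unshifted path the
  same law.\<close>

lemma measure_no_upcrossing_shift:
  fixes X :: "nat \<Rightarrow> 'a \<Rightarrow> real ^ 'd"
  assumes st: "stationary_seq M X"
  shows "measure M (no_upcrossing M X v h m) = measure M (no_upcrossing M X v 0 m)"
proof -
  define I where "I = {1..m + 1}"
  define P where "P = PiM I (\<lambda>_. borel :: (real ^ 'd) measure)"
  define S where "S = {x \<in> space P. \<forall>i\<in>{1..m}. \<forall>j. \<not> (x i $ j \<le> v $ j \<and> v $ j < x (i + 1) $ j)}"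
  have comp: "(\<lambda>x. x i) \<in> borel_measurable P" if "i \<in> I" for i
    unfolding P_def using that by (rule measurable_component_singleton)
  have S: "S \<in> sets P"
    unfolding S_def
  proof (intro sets.sets_Collect_finite_All sets.sets_Collect_countable_All sets.sets_Collect_neg sets.sets_Collect_conj)
    fix i j assume "i \<in> {1..m}"
    then have [measurable]: "(\<lambda>x. x i) \<in> borel_measurable P" "(\<lambda>x. x (i + 1)) \<in> borel_measurable P"
      by (auto intro!: comp simp: I_def)
    show "{x \<in> space P. x i $ j \<le> v $ j} \<in> sets P" by measurable
    show "{x \<in> space P. v $ j < x (i + 1) $ j} \<in> sets P" by measurable
  qed auto
  have pull: "measure M (no_upcrossing M X v g m)
      = measure (distr M P (\<lambda>\<omega>. \<lambda>i\<in>I. X (i + g) \<omega>)) S" for g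
  proof -
    have meas: "(\<lambda>\<omega>. \<lambda>i\<in>I. X (i + g) \<omega>) \<in> measurable M P"
      unfolding P_def
      by (rule measurable_restrict) (auto simp: I_def intro!: stationary_seq_measurable[OF st])
    have "(\<lambda>\<omega>. \<lambda>i\<in>I. X (i + g) \<omega>) -` S \<inter> space M = no_upcrossing M X v g m"
    proof -
      have "(\<lambda>i\<in>I. X (i + g) \<omega>) \<in> S \<longleftrightarrow> \<omega> \<in> no_upcrossing M X v g m" if "\<omega> \<in> space M" for \<omega>
      proof -
        have "(\<lambda>i\<in>I. X (i + g) \<omega>) \<in> S \<longleftrightarrow>
            (\<forall>i\<in>{1..m}. \<forall>j. \<not> (X (i + g) \<omega> $ j \<le> v $ j \<and> v $ j < X (i + g + 1) \<omega> $ j))"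
          using measurable_space[OF meas that] by (auto simp: S_def I_def)
        also have "\<dots> \<longleftrightarrow> (\<forall>i\<in>(\<lambda>i. i + g) ` {1..m}. \<omega> \<notin> (\<Union>j. upcrossing M X v i j))"
          using that by (simp add: upcrossing_def del: image_add_atLeastAtMost')
        also have "(\<lambda>i. i + g) ` {1..m} = {g<..g + m}"
          by (auto simp: image_add_atLeastAtMost' atLeastSucAtMost_greaterThanAtMost[symmetric])
        finally show ?thesis using that unfolding no_upcrossing_def by blast
      qed
      then show ?thesis by (auto simp: no_upcrossing_def)
    qed
    with measure_distr[OF meas S] show ?thesis by simp
  qed
  have "distr M P (\<lambda>\<omega>. \<lambda>i\<in>I. X (i + h) \<omega>) = distr M P (\<lambda>\<omega>. \<lambda>i\<in>I. X i \<omega>)"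
    using st unfolding stationary_seq_def P_def I_def by auto
  with pull[of h] pull[of 0] show ?thesis by simp
qed

section \<open>Union bounds from stationarity\<close>

context prob_space
begin

text \<open>An upcrossing at \<open>Suc g\<close> is the complement of a clear block of length 1
  after \<open>g\<close>, so the shift invariance of blocks applies.\<close>

lemma prob_any_upcrossing:
  fixes X :: "nat \<Rightarrow> 'a \<Rightarrow> real ^ 'd"
  assumes st: "stationary_seq M X" and "1 \<le> i"
  shows "prob (\<Union>j. upcrossing M X v i j) = prob (\<Union>j. upcrossing M X v 1 j)"
proof -
  have *: "prob (\<Union>j. upcrossing M X v (Suc g) j) = 1 - prob (no_upcrossing M X v g 1)" for g
  proof -
    have "(\<Union>j. upcrossing M X v (Suc g) j) = space M - no_upcrossing M X v g 1"
    proof -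
      have "{g<..g + 1} = {Suc g}" by auto
      then show ?thesis by (auto simp: no_upcrossing_def upcrossing_def)
    qed
    then show ?thesis using prob_compl[OF no_upcrossing_sets[OF st]] by simp
  qed
  from assms obtain g where "i = Suc g" by (cases i) auto
  then show ?thesis
    using *[of g] *[of 0] measure_no_upcrossing_shift[OF st, of v g 1] by simp
qed

text \<open>This is a union bound over \<open>J\<close>, all positions being equally likely to carry
  an upcrossing. It gives the price of dropping the positions in \<open>J\<close> from the event
  that there is no upcrossing.\<close>

lemma prob_diff_le_upcrossings:
  fixes X :: "nat \<Rightarrow> 'a \<Rightarrow> real ^ 'd"
  assumes st: "stationary_seq M X" and J: "finite J" "J \<subseteq> {1..}"
    and sets: "A \<in> events" "B \<in> events" and "A \<subseteq> B"
    and cover: "B - A \<subseteq> (\<Union>i\<in>J. \<Union>j. upcrossing M X v i j)"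
  shows "\<bar>prob A - prob B\<bar> \<le> real (card J) * prob (\<Union>j. upcrossing M X v 1 j)"
proof -
  have ev: "(\<Union>j. upcrossing M X v i j) \<in> events" if "i \<in> J" for i
    using J that by (intro any_upcrossing_sets[OF st]) auto
  have "\<bar>prob A - prob B\<bar> = prob (B - A)"
    using sets \<open>A \<subseteq> B\<close> finite_measure_mono[of A B] by (simp add: finite_measure_Diff)
  also have "\<dots> \<le> prob (\<Union>i\<in>J. \<Union>j. upcrossing M X v i j)"
    using cover by (rule finite_measure_mono) (rule sets.finite_UN[OF J(1) ev])
  also have "\<dots> \<le> (\<Sum>i\<in>J. prob (\<Union>j. upcrossing M X v i j))"
    using ev J by (intro finite_measure_subadditive_finite) auto
  also have "\<dots> = (\<Sum>i\<in>J. prob (\<Union>j. upcrossing M X v 1 j))"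
    using J by (intro sum.cong refl prob_any_upcrossing[OF st]) auto
  finally show ?thesis by simp
qed

section \<open>Approximate independence of separated blocks\<close>

text \<open>A real \<open>Sup\<close> dominates the elements of a set once the set is bounded above;
  here 1 is a bound, since both terms of the difference lie between 0 and 1.\<close>

lemma mixing_coeff_ge:
  assumes "A \<in> level_sigma M X (u n) 1 k" "B \<in> level_sigma M X (u n) (k + l) n"
    and "1 \<le> k" "k + l \<le> n"
  shows "\<bar>prob (A \<inter> B) - prob A * prob B\<bar> \<le> mixing_coeff M X u n l"
  unfolding mixing_coeff_def
proof (rule cSup_upper)
  show "bdd_above {\<bar>prob (A \<inter> B) - prob A * prob B\<bar> | A B k.
            A \<in> level_sigma M X (u n) 1 k \<and> B \<in> level_sigma M X (u n) (k + l) n \<and>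
            1 \<le> k \<and> k + l \<le> n}"
  proof (rule bdd_aboveI[of _ 1])
    have "\<bar>prob (A \<inter> B) - prob A * prob B\<bar> \<le> 1" for A B
    proof -
      have "0 \<le> prob A * prob B" "prob A * prob B \<le> 1" "0 \<le> prob (A \<inter> B)" "prob (A \<inter> B) \<le> 1"
        by (auto intro: mult_le_one)
      then show ?thesis by linarith
    qed
    then show "x \<le> 1" if "x \<in> {\<bar>prob (A \<inter> B) - prob A * prob B\<bar> | A B k.
            A \<in> level_sigma M X (u n) 1 k \<and> B \<in> level_sigma M X (u n) (k + l) n \<and>
            1 \<le> k \<and> k + l \<le> n}" for x
      using that by auto
  qed
qed (use assms in blast)

text \<open>Leaving out the last \<open>l\<close> positions of each block separates neighbouring
  blocks enough for mixing, so each block after the first costs one mixing coefficient. The error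
  made before is multiplied by a probability and does not grow.\<close>

lemma prob_blocks_product:
  fixes X :: "nat \<Rightarrow> 'a \<Rightarrow> real ^ 'd"
  assumes st: "stationary_seq M X" and "0 < l" "l \<le> r" "k * r \<le> n" "m \<le> k"
  shows "\<bar>prob {\<omega> \<in> space M. \<forall>i<m. \<omega> \<in> no_upcrossing M X (u n) (i * r) (r - l)}
      - prob (no_upcrossing M X (u n) 0 (r - l)) ^ m\<bar> \<le> real (m - 1) * mixing_coeff M X u n l"
  using \<open>m \<le> k\<close>
proof (induction m)
  case 0
  then show ?case by (simp add: prob_space)
next
  case (Suc m)
  define F where "F i = no_upcrossing M X (u n) (i * r) (r - l)" for i
  define G where "G = {\<omega> \<in> space M. \<forall>i<m. \<omega> \<in> F i}"
  define p where "p = prob (no_upcrossing M X (u n) 0 (r - l))"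
  define \<alpha> where "\<alpha> = mixing_coeff M X u n l"
  have pF: "prob (F i) = p" for i
    unfolding F_def p_def by (rule measure_no_upcrossing_shift[OF st])
  have p01: "0 \<le> p" "p \<le> 1" by (auto simp: p_def)
  have IH: "\<bar>prob G - p ^ m\<bar> \<le> real (m - 1) * \<alpha>"
    using Suc by (simp add: G_def F_def p_def \<alpha>_def)
  have F_sub: "F i \<subseteq> space M" for i by (auto simp: F_def no_upcrossing_def)
  have G_Suc: "{\<omega> \<in> space M. \<forall>i<Suc m. \<omega> \<in> F i} = G \<inter> F m"
    using F_sub by (auto simp: G_def less_Suc_eq)
  have bound: "m * r + r \<le> n"
  proof -
    have "(m + 1) * r \<le> k * r" using Suc.prems by (intro mult_right_mono) auto
    with \<open>k * r \<le> n\<close> show ?thesis by simp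
  qed
  have "\<bar>prob (G \<inter> F m) - p ^ Suc m\<bar> \<le> real m * \<alpha>"
  \<comment> \<open>The first block stands alone and costs nothing, which is why the bound counts
    \<open>m - 1\<close>.\<close>
  proof (cases "m = 0")
    case True
    then have "G \<inter> F m = F 0" using F_sub[of 0] by (auto simp: G_def)
    then show ?thesis using True pF by simp
  next
    case False
    \<comment> \<open>The blocks before block \<open>m\<close> have their last position at
      \<open>m * r - l\<close>, hence use indices up to \<open>e\<close>, one more. Block
      \<open>m\<close> starts at \<open>m * r + 1 = e + l\<close>, so the gap is exactly
      \<open>l\<close>.\<close>
    define e where "e = m * r - l + 1"
    have le: "l \<le> m * r" using False \<open>l \<le> r\<close> by (cases m) auto
    have F_in: "F i \<in> level_sigma M X (u n) 1 e" if "i < m" for i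
      unfolding F_def
    proof (rule no_upcrossing_in_level_sigma)
      have "(i + 1) * r \<le> m * r" using that by (intro mult_right_mono) auto
      then show "i * r + (r - l) + 1 \<le> e"
        using \<open>l \<le> r\<close> unfolding e_def by (simp add: algebra_simps)
    qed simp
    interpret L: sigma_algebra "space M" "level_sigma M X (u n) 1 e"
      unfolding level_sigma_def by (rule sigma_algebra_sigma_sets) auto
    have "G = (\<Inter>i\<in>{..<m}. F i)" using False F_sub by (auto simp: G_def)
    moreover have "(\<Inter>i\<in>{..<m}. F i) \<in> level_sigma M X (u n) 1 e"
      using False F_in by (intro L.finite_INT) auto
    ultimately have "G \<in> level_sigma M X (u n) 1 e"
      by simp
    \<comment> \<open>Block \<open>m\<close> uses indices up to \<open>m * r + (r - l) + 1\<close>,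
      which is at most \<open>m * r + r\<close> because \<open>0 < l\<close>.\<close>
    moreover have "F m \<in> level_sigma M X (u n) (e + l) n"
      unfolding F_def e_def using le bound \<open>0 < l\<close> \<open>l \<le> r\<close>
      by (intro no_upcrossing_in_level_sigma) auto
    ultimately have "\<bar>prob (G \<inter> F m) - prob G * p\<bar> \<le> \<alpha>"
      unfolding \<alpha>_def pF[of m, symmetric]
      using le bound \<open>0 < l\<close> \<open>l \<le> r\<close> by (intro mixing_coeff_ge[of _ _ _ _ e]) (auto simp: e_def)
    moreover have "\<bar>prob G * p - p ^ Suc m\<bar> \<le> real (m - 1) * \<alpha>"
    proof -
      have "prob G * p - p ^ Suc m = (prob G - p ^ m) * p"
        by (simp add: algebra_simps)
      then have "\<bar>prob G * p - p ^ Suc m\<bar> = \<bar>prob G - p ^ m\<bar> * p"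
        using p01 by (simp add: abs_mult)
      also have "\<dots> \<le> \<bar>prob G - p ^ m\<bar>"
        using p01 by (simp add: mult_left_le)
      finally show ?thesis using IH by simp
    qed
    moreover have "real (m - 1) * \<alpha> + \<alpha> = real m * \<alpha>"
      using False by (simp add: of_nat_diff algebra_simps)
    ultimately show ?thesis by linarith
  qed
  then show ?case using G_Suc by (simp add: F_def p_def \<alpha>_def)
qed

text \<open>
  Discarding the last \<open>l\<close> positions of each block of length \<open>r\<close> makes the mixing condition
  applicable to consecutive blocks.
\<close>

lemma no_upcrossing_block_approx:
  fixes X :: "nat \<Rightarrow> 'a \<Rightarrow> real ^ 'd"
  assumes st: "stationary_seq M X" and "0 < l" "0 < k" "k * l \<le> n" and r: "r = n div k"
  shows "\<bar>prob (no_upcrossing M X (u n) 0 n) - prob (no_upcrossing M X (u n) 0 r) ^ k\<bar>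
      \<le> real k * \<bar>mixing_coeff M X u n l\<bar>
        + real (2 * k * l + k) * prob (\<Union>j. upcrossing M X (u n) 1 j)"
proof -
  define w where "w = prob (\<Union>j. upcrossing M X (u n) 1 j)"
  define \<alpha> where "\<alpha> = mixing_coeff M X u n l"
  define F where "F i = no_upcrossing M X (u n) (i * r) (r - l)" for i
  define E where "E = {\<omega> \<in> space M. \<forall>i<k. \<omega> \<in> F i}"
  \<comment> \<open>These are the discarded positions: the last \<open>l\<close> of each of the
    \<open>k\<close> blocks, and the remainder of \<open>n\<close> after
    \<open>k * r\<close>.\<close>
  define J where "J = (\<Union>i<k. {i * r + (r - l)<..i * r + r}) \<union> {k * r<..n}"
  have "l \<le> r"
    using \<open>k * l \<le> n\<close> \<open>0 < k\<close> div_le_mono[of "k * l" n k] by (simp add: r)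
  with \<open>0 < l\<close> have "0 < r" by simp
  have kr: "k * r \<le> n" by (simp add: r)
  have rem: "n - k * r \<le> k"
    using \<open>0 < k\<close> mod_less_divisor[of k n] by (simp add: r minus_mult_div_eq_mod)
  have F_ev: "F i \<in> events" for i unfolding F_def by (rule no_upcrossing_sets[OF st])
  have E_ev: "E \<in> events"
    unfolding E_def using F_ev by measurable
  have cardJ: "card J \<le> k * l + k"
  proof -
    have "card J \<le> card (\<Union>i<k. {i * r + (r - l)<..i * r + r}) + card {k * r<..n}"
      unfolding J_def by (rule card_Un_le)
    also have "card (\<Union>i<k. {i * r + (r - l)<..i * r + r}) \<le> (\<Sum>i<k. card {i * r + (r - l)<..i * r + r})"
      by (rule card_UN_le) simp
    also have "\<dots> = k * l" using \<open>l \<le> r\<close> by simp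
    finally show ?thesis using rem by simp
  qed
  have "\<bar>prob (no_upcrossing M X (u n) 0 n) - prob E\<bar> \<le> real (card J) * w"
    unfolding w_def
  proof (rule prob_diff_le_upcrossings[OF st _ _ no_upcrossing_sets[OF st] E_ev])
    show "finite J" "J \<subseteq> {1..}" by (auto simp: J_def)
    show "no_upcrossing M X (u n) 0 n \<subseteq> E"
    proof
      fix \<omega> assume \<omega>: "\<omega> \<in> no_upcrossing M X (u n) 0 n"
      have "\<omega> \<in> F i" if "i < k" for i
      proof -
        have "(i + 1) * r \<le> k * r" using that by (intro mult_right_mono) auto
        then have "{i * r<..i * r + (r - l)} \<subseteq> {0<..0 + n}" using kr by auto
        then show ?thesis using \<omega> unfolding F_def no_upcrossing_def by blast
      qed
      with \<omega> show "\<omega> \<in> E" by (auto simp: E_def no_upcrossing_def)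
    qed
    show "E - no_upcrossing M X (u n) 0 n \<subseteq> (\<Union>i\<in>J. \<Union>j. upcrossing M X (u n) i j)"
    proof
      fix \<omega> assume \<omega>: "\<omega> \<in> E - no_upcrossing M X (u n) 0 n"
      then have "\<not> (\<forall>i\<in>{0<..0 + n}. \<omega> \<notin> (\<Union>j. upcrossing M X (u n) i j))"
        by (simp add: E_def no_upcrossing_def del: UN_iff)
      then obtain x where x: "0 < x" "x \<le> n" "\<omega> \<in> (\<Union>j. upcrossing M X (u n) x j)"
        by (metis add_0 greaterThanAtMost_iff)
      have "x \<in> J"
      proof (cases "k * r < x")
        case False
        \<comment> \<open>Positions count from 1, so block \<open>i\<close> holds
          \<open>i * r + 1\<close> to \<open>i * r + r\<close>; this explains the
          \<open>x - 1\<close>.\<close>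
        define i where "i = (x - 1) div r"
        have i: "i * r < x" "x \<le> i * r + r"
          using x \<open>0 < r\<close> div_mult_mod_eq[of "x - 1" r] mod_less_divisor[of r "x - 1"]
          unfolding i_def by linarith+
        have "i < k" unfolding i_def using x \<open>0 < r\<close> False by (intro less_mult_imp_div_less) auto
        moreover have "\<not> x \<le> i * r + (r - l)"
        proof
          assume "x \<le> i * r + (r - l)"
          with \<omega> \<open>i < k\<close> i(1) have "\<omega> \<notin> (\<Union>j. upcrossing M X (u n) x j)"
            by (auto simp: E_def F_def no_upcrossing_def)
          with x show False by simp
        qed
        ultimately show ?thesis using i by (force simp: J_def)
      qed (use x in \<open>auto simp: J_def\<close>)
      with x show "\<omega> \<in> (\<Union>i\<in>J. \<Union>j. upcrossing M X (u n) i j)" by blast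
    qed
  qed
  also have "\<dots> \<le> real (k * l + k) * w"
    using cardJ by (intro mult_right_mono of_nat_mono) (auto simp: w_def)
  finally have 1: "\<bar>prob (no_upcrossing M X (u n) 0 n) - prob E\<bar> \<le> real (k * l + k) * w" .
  have "\<bar>prob E - prob (F 0) ^ k\<bar> \<le> real (k - 1) * \<alpha>"
    using prob_blocks_product[OF st \<open>0 < l\<close> \<open>l \<le> r\<close> kr order_refl, of u]
    by (simp add: E_def F_def \<alpha>_def)
  \<comment> \<open>With the absolute value, \<open>k - 1\<close> can be enlarged to
    \<open>k\<close> without knowing the sign of \<open>\<alpha>\<close>.\<close>
  also have "\<dots> \<le> real (k - 1) * \<bar>\<alpha>\<bar>"
    by (intro mult_left_mono) auto
  also have "\<dots> \<le> real k * \<bar>\<alpha>\<bar>"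
    by (intro mult_right_mono) auto
  finally have 2: "\<bar>prob E - prob (F 0) ^ k\<bar> \<le> real k * \<bar>\<alpha>\<bar>" .
  have "\<bar>prob (no_upcrossing M X (u n) 0 r) - prob (F 0)\<bar> \<le> real (card {r - l<..r}) * w"
    unfolding w_def
  proof (rule prob_diff_le_upcrossings[OF st _ _ no_upcrossing_sets[OF st] F_ev])
    show "no_upcrossing M X (u n) 0 r \<subseteq> F 0"
      by (auto simp: F_def no_upcrossing_def)
    show "F 0 - no_upcrossing M X (u n) 0 r
        \<subseteq> (\<Union>i\<in>{r - l<..r}. \<Union>j. upcrossing M X (u n) i j)"
      unfolding F_def no_upcrossing_def using not_le by fastforce
  qed auto
  also have "card {r - l<..r} = l" using \<open>l \<le> r\<close> by simp
  finally have 3: "\<bar>prob (no_upcrossing M X (u n) 0 r) - prob (F 0)\<bar> \<le> real l * w" .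
  \<comment> \<open>On \<open>[0, 1]\<close> the \<open>k\<close>-th power is Lipschitz with
    constant \<open>k\<close>. Restoring the \<open>l\<close> dropped positions in each factor thus
    costs a second \<open>k * l * w\<close>, whence the factor 2 in the bound.\<close>
  have "\<bar>prob (no_upcrossing M X (u n) 0 r) ^ k - prob (F 0) ^ k\<bar>
      \<le> real k * \<bar>prob (no_upcrossing M X (u n) 0 r) - prob (F 0)\<bar>"
    using norm_power_diff[of "prob (no_upcrossing M X (u n) 0 r)" "prob (F 0)" k] by simp
  also have "\<dots> \<le> real k * (real l * w)"
    using 3 by (rule mult_left_mono) simp
  finally have "\<bar>prob (no_upcrossing M X (u n) 0 r) ^ k - prob (F 0) ^ k\<bar> \<le> real (k * l) * w"
    by simp
  with 1 2 show ?thesis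
    unfolding w_def[symmetric] \<alpha>_def[symmetric] by (simp add: algebra_simps)
qed

section \<open>Counting upcrossings and the mean cluster size\<close>

lemma upcrossings_count_eq_0_iff:
  "\<omega> \<in> space M \<Longrightarrow> upcrossings_count M X v m \<omega> = 0 \<longleftrightarrow> \<omega> \<in> no_upcrossing M X v 0 m"
  unfolding upcrossings_count_def no_upcrossing_def
  by (subst sum_nonneg_eq_0_iff) (auto simp: indicator_eq_0_iff)

text \<open>All points \<open>i / n\<close> with \<open>1 \<le> i \<le> n\<close> lie in
  \<open>[0, 1]\<close>, so no upcrossing is lost. This expresses the second limit in the definition
  of the index through blocks.\<close>

lemma prob_upcrossings_process_eq_0:
  fixes X :: "nat \<Rightarrow> 'a \<Rightarrow> real ^ 'd"
  shows "\<P>(\<omega> in M. upcrossings_process M X u n \<omega> {0..1} = 0) = prob (no_upcrossing M X (u n) 0 n)"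
proof -
  have "upcrossings_process M X u n \<omega> {0..1} = 0 \<longleftrightarrow> \<omega> \<in> no_upcrossing M X (u n) 0 n"
    if "\<omega> \<in> space M" for \<omega>
  proof -
    have "upcrossings_process M X u n \<omega> {0..1} $ j
        = (\<Sum>i=1..n. indicator (upcrossing M X (u n) i j) \<omega>)" for j
      unfolding upcrossings_process_def vec_lambda_beta
      by (intro sum.cong refl) (auto simp: indicator_def)
    moreover have "(\<Sum>i=1..n. indicator (upcrossing M X (u n) i j) \<omega>) = (0 :: real) \<longleftrightarrow>
        (\<forall>i\<in>{0<..n}. \<omega> \<notin> upcrossing M X (u n) i j)" for j
      by (subst sum_nonneg_eq_0_iff) (auto simp: indicator_eq_0_iff)
    ultimately show ?thesis
      using that by (auto simp: vec_eq_iff no_upcrossing_def)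
  qed
  then have "{\<omega> \<in> space M. upcrossings_process M X u n \<omega> {0..1} = 0} = no_upcrossing M X (u n) 0 n"
    by (auto simp: no_upcrossing_def)
  then show ?thesis by simp
qed

lemma real_upcrossings_count:
  "real (upcrossings_count M X v m \<omega>) = (\<Sum>i=1..m. indicator (\<Union>j. upcrossing M X v i j) \<omega>)"
  unfolding upcrossings_count_def of_nat_sum
  by (intro sum.cong refl) (auto simp: indicator_def)

lemma upcrossings_count_le: "upcrossings_count M X v m \<omega> \<le> m"
proof -
  have "upcrossings_count M X v m \<omega> \<le> (\<Sum>i=1..m. 1)"
    unfolding upcrossings_count_def by (intro sum_mono) (auto simp: indicator_def)
  then show ?thesis by simp
qed

lemma upcrossings_count_eq_sets:
  fixes X :: "nat \<Rightarrow> 'a \<Rightarrow> real ^ 'd"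
  assumes st: "stationary_seq M X"
  shows "{\<omega> \<in> space M. upcrossings_count M X v m \<omega> = k} \<in> events"
proof -
  have "(\<lambda>\<omega>. real (upcrossings_count M X v m \<omega>)) \<in> borel_measurable M"
    unfolding real_upcrossings_count
    by (intro borel_measurable_sum borel_measurable_indicator any_upcrossing_sets[OF st]) auto
  then have "{\<omega> \<in> space M. real (upcrossings_count M X v m \<omega>) = real k} \<in> events"
    by (intro borel_measurable_eq) auto
  then show ?thesis by simp
qed

text \<open>Both sides are the expectation of the count: summed over its values on the left, by
  linearity and stationarity on the right.\<close>

lemma sum_upcrossings_count:
  fixes X :: "nat \<Rightarrow> 'a \<Rightarrow> real ^ 'd"
  assumes st: "stationary_seq M X"
  shows "(\<Sum>k=1..m. real k * \<P>(\<omega> in M. upcrossings_count M X v m \<omega> = k))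
      = real m * prob (\<Union>j. upcrossing M X v 1 j)"
proof -
  define N where "N = upcrossings_count M X v m"
  have N_sets: "{\<omega> \<in> space M. N \<omega> = k} \<in> events" for k
    unfolding N_def by (rule upcrossings_count_eq_sets[OF st])
  have N_le: "N \<omega> \<le> m" for \<omega>
    unfolding N_def by (rule upcrossings_count_le)
  have N_eq: "real (N \<omega>) = (\<Sum>k=1..m. real k * indicator {\<omega> \<in> space M. N \<omega> = k} \<omega>)"
    if "\<omega> \<in> space M" for \<omega>
  proof -
    have "(\<Sum>k=1..m. real k * indicator {\<omega> \<in> space M. N \<omega> = k} \<omega>)
        = (\<Sum>k=1..m. if N \<omega> = k then real k else 0)"
      using that by (intro sum.cong) auto
    also have "\<dots> = real (N \<omega>)"
      using N_le[of \<omega>] by (simp add: not_le)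
    finally show ?thesis by simp
  qed
  have "(\<Sum>k=1..m. real k * \<P>(\<omega> in M. N \<omega> = k))
      = (\<integral>\<omega>. (\<Sum>k=1..m. real k * indicator {\<omega> \<in> space M. N \<omega> = k} \<omega>) \<partial>M)"
    by (subst Bochner_Integration.integral_sum)
      (auto intro!: integrable_mult_right integrable_real_indicator N_sets simp: less_top[symmetric] intro!: sum.cong arg_cong[where f = prob])
  also have "\<dots> = (\<integral>\<omega>. (\<Sum>i=1..m. indicator (\<Union>j. upcrossing M X v i j) \<omega>) \<partial>M)"
    by (intro Bochner_Integration.integral_cong refl)
      (simp only: N_eq[symmetric], simp only: N_def real_upcrossings_count)
  also have "\<dots> = (\<Sum>i=1..m. prob (\<Union>j. upcrossing M X v i j))"
    using any_upcrossing_sets[OF st]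
    by (subst Bochner_Integration.integral_sum) (auto simp: less_top[symmetric])
  also have "\<dots> = (\<Sum>i=1..m. prob (\<Union>j. upcrossing M X v 1 j))"
    by (intro sum.cong refl prob_any_upcrossing[OF st]) auto
  finally show ?thesis by (simp add: N_def)
qed

text \<open>The count is at most \<open>r n\<close>, so the infinite sum is finite, and conditioning
  only divides the expectation by \<open>P(N > 0)\<close>. If that probability is 0, both sides are
  0, as division by zero yields 0.\<close>

lemma mean_cluster_size:
  fixes X :: "nat \<Rightarrow> 'a \<Rightarrow> real ^ 'd"
  assumes st: "stationary_seq M X"
  shows "(\<Sum>\<^sub>\<infinity>m\<in>{1..}. real m * cluster_prob M X u r n m)
      = real (r n) * prob (\<Union>j. upcrossing M X (u n) 1 j)
        / (1 - prob (no_upcrossing M X (u n) 0 (r n)))"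
proof -
  define N where "N = upcrossings_count M X (u n) (r n)"
  have N_le: "N \<omega> \<le> r n" for \<omega>
    unfolding N_def by (rule upcrossings_count_le)
  have pos: "\<P>(\<omega> in M. 0 < N \<omega>) = 1 - prob (no_upcrossing M X (u n) 0 (r n))"
  proof -
    have "{\<omega> \<in> space M. 0 < N \<omega>} = space M - no_upcrossing M X (u n) 0 (r n)"
      using upcrossings_count_eq_0_iff[of _ X "u n" "r n"] by (auto simp: N_def simp flip: neq0_conv)
    then show ?thesis using prob_compl[OF no_upcrossing_sets[OF st]] by simp
  qed
  have cp: "cluster_prob M X u r n m = \<P>(\<omega> in M. N \<omega> = m) / \<P>(\<omega> in M. 0 < N \<omega>)" if "1 \<le> m" for m
  proof -
    have "{\<omega> \<in> space M. N \<omega> = m \<and> 0 < N \<omega>} = {\<omega> \<in> space M. N \<omega> = m}"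
      using that by auto
    then show ?thesis by (simp add: cluster_prob_def cond_prob_def N_def)
  qed
  have "(\<Sum>\<^sub>\<infinity>m\<in>{1..}. real m * cluster_prob M X u r n m)
      = (\<Sum>\<^sub>\<infinity>m\<in>{1..r n}. real m * cluster_prob M X u r n m)"
  proof (rule infsum_cong_neutral)
    fix m assume m: "m \<in> {1..} - {1..r n}"
    then have "{\<omega> \<in> space M. N \<omega> = m} = {}" using N_le not_le by auto
    then have "\<P>(\<omega> in M. N \<omega> = m) = 0" by (metis measure_empty)
    with m cp[of m] show "real m * cluster_prob M X u r n m = 0" by simp
  qed auto
  also have "\<dots> = (\<Sum>m=1..r n. real m * \<P>(\<omega> in M. N \<omega> = m)) / \<P>(\<omega> in M. 0 < N \<omega>)"
    by (simp add: cp sum_divide_distrib)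
  also have "(\<Sum>m=1..r n. real m * \<P>(\<omega> in M. N \<omega> = m))
      = real (r n) * prob (\<Union>j. upcrossing M X (u n) 1 j)"
    unfolding N_def by (rule sum_upcrossings_count[OF st])
  finally show ?thesis unfolding pos .
qed

end

section \<open>From the limit of a power to the limit of a product\<close>

text \<open>Logarithms give \<open>- k ln (1 - q) \<longlonglongrightarrow> c\<close>. For
  \<open>q < 1\<close> the inequality \<open>ln x \<le> x - 1\<close>, applied to
  \<open>1 - q\<close> and to its reciprocal, yields
  \<open>(1 - q) * - ln (1 - q) \<le> q \<le> - ln (1 - q)\<close>, and the factor
  \<open>1 - q\<close> tends to 1.\<close>

lemma tendsto_mult_one_minus_of_power:
  fixes q :: "nat \<Rightarrow> real" and k :: "nat \<Rightarrow> nat"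
  assumes "(\<lambda>n. (1 - q n) ^ k n) \<longlonglongrightarrow> exp (- c)" and q0: "q \<longlonglongrightarrow> 0"
  shows "(\<lambda>n. real (k n) * q n) \<longlonglongrightarrow> c"
proof -
  have ev: "\<forall>\<^sub>F n in sequentially. q n < 1"
    using q0 by (rule order_tendstoD) simp
  have "(\<lambda>n. - ln ((1 - q n) ^ k n)) \<longlonglongrightarrow> - ln (exp (- c))"
    by (intro tendsto_minus tendsto_ln assms) simp
  then have upper: "(\<lambda>n. - (real (k n) * ln (1 - q n))) \<longlonglongrightarrow> c"
    by (simp add: ln_realpow)
  have lower: "(\<lambda>n. (1 - q n) * - (real (k n) * ln (1 - q n))) \<longlonglongrightarrow> c"
    using tendsto_mult[OF tendsto_diff[OF tendsto_const[of 1] q0] upper] by simp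
  show ?thesis
  proof (rule tendsto_sandwich[OF _ _ lower upper])
    show "\<forall>\<^sub>F n in sequentially. (1 - q n) * - (real (k n) * ln (1 - q n)) \<le> real (k n) * q n"
      using ev
    proof eventually_elim
      case (elim n)
      have "- ln (1 - q n) = ln (1 / (1 - q n))"
        using elim by (simp add: ln_div)
      also have "\<dots> \<le> 1 / (1 - q n) - 1"
        using elim by (intro ln_le_minus_one) simp
      finally have "(1 - q n) * - ln (1 - q n) \<le> q n"
        using elim by (simp add: field_simps)
      then have "real (k n) * ((1 - q n) * - ln (1 - q n)) \<le> real (k n) * q n"
        by (rule mult_left_mono) simp
      then show ?case by (simp add: mult_ac)
    qed
    show "\<forall>\<^sub>F n in sequentially. real (k n) * q n \<le> - (real (k n) * ln (1 - q n))"
      using ev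
    proof eventually_elim
      case (elim n)
      have "q n \<le> - ln (1 - q n)"
        using ln_le_minus_one[of "1 - q n"] elim by simp
      then have "real (k n) * q n \<le> real (k n) * - ln (1 - q n)"
        by (rule mult_left_mono) simp
      then show ?case by simp
    qed
  qed
qed

section \<open>Convergence of the mean cluster size\<close>

theorem proposition3p2:
  fixes M :: "'a measure"
    and X :: "nat \<Rightarrow> 'a \<Rightarrow> real ^ 'd"
    and \<eta> :: "real ^ 'd \<Rightarrow> real"
  assumes "prob_space M"
    and "stationary_seq M X"
    and "\<And>\<nu>. (\<forall>j. 0 < \<nu> $ j) \<Longrightarrow> \<exists>u. is_levels M X \<nu> u"
    and "\<And>\<nu> u. (\<forall>j. 0 < \<nu> $ j) \<Longrightarrow> is_levels M X \<nu> u \<Longrightarrow> condition_Delta M X u"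
    and "multivariate_upcrossings_index M X \<eta>"
    and "\<And>\<nu>. (\<forall>j. 0 < \<nu> $ j) \<Longrightarrow> 0 < \<eta> \<nu>"
  shows "\<forall>\<nu> u l k.
    (\<forall>j. 0 < \<nu> $ j) \<longrightarrow>
    is_levels M X \<nu> u \<longrightarrow>
    Delta_gap M X u l \<longrightarrow>
    (\<forall>n\<ge>1. 0 < k n) \<longrightarrow>
    filterlim k at_top sequentially \<longrightarrow>
    (\<lambda>n. real (k n) * real (l n) / real n) \<longlonglongrightarrow> 0 \<longrightarrow>
    (\<lambda>n. real (k n) * mixing_coeff M X u n (l n)) \<longlonglongrightarrow> 0 \<longrightarrow>
    (\<lambda>n. \<Sum>\<^sub>\<infinity>m\<in>{1..}. real m * cluster_prob M X u (\<lambda>n. n div k n) n m) \<longlonglongrightarrow> 1 / \<eta> \<nu>"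
proof (intro allI impI)
  fix \<nu> u l k
  assume \<nu>: "\<forall>j. 0 < \<nu> $ j" and lev: "is_levels M X \<nu> u" and gap: "Delta_gap M X u l"
    and k_pos: "\<forall>n\<ge>1. 0 < k n" and k_top: "filterlim k at_top sequentially"
    and kl: "(\<lambda>n. real (k n) * real (l n) / real n) \<longlonglongrightarrow> 0"
    and k\<alpha>: "(\<lambda>n. real (k n) * mixing_coeff M X u n (l n)) \<longlonglongrightarrow> 0"
  interpret prob_space M by fact
  note st = \<open>stationary_seq M X\<close>
  define w where "w n = prob (\<Union>j. upcrossing M X (u n) 1 j)" for n
  define r where "r n = n div k n" for n
  define q where "q n = 1 - prob (no_upcrossing M X (u n) 0 (r n))" for n
  have w_nonneg: "0 \<le> w n" for n by (simp add: w_def)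
  have l_pos: "0 < l n" if "1 \<le> n" for n using gap that by (auto simp: Delta_gap_def)
  obtain \<phi> where \<phi>: "(\<lambda>n. exp (- (real n * w n))) \<longlonglongrightarrow> \<phi> \<nu>"
    and clear: "(\<lambda>n. prob (no_upcrossing M X (u n) 0 n)) \<longlonglongrightarrow> \<phi> \<nu> powr \<eta> \<nu>"
    using assms(5) \<nu> lev
    unfolding multivariate_upcrossings_index_def w_def prob_upcrossings_process_eq_0 by blast

  define \<tau> where "\<tau> = - ln (\<phi> \<nu>)"
  have single: "(\<lambda>n. real n * prob (upcrossing M X (u n) 1 j)) \<longlonglongrightarrow> \<nu> $ j" for j
    using lev by (simp add: is_levels_def)
  have ev: "upcrossing M X (u n) 1 j \<in> events" for n j
    by (rule upcrossing_sets[OF st]) simp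
  \<comment> \<open>By the union bound over the components, \<open>n * w n\<close> stays below a
    sequence with the finite limit \<open>\<Sum>j\<in>UNIV. \<nu> $ j\<close>, so the exponentials
    cannot tend to 0.\<close>
  have \<phi>_pos: "0 < \<phi> \<nu>"
  proof -
    have "(\<lambda>n. exp (- (\<Sum>j\<in>UNIV. real n * prob (upcrossing M X (u n) 1 j))))
        \<longlonglongrightarrow> exp (- (\<Sum>j\<in>UNIV. \<nu> $ j))"
      by (intro tendsto_intros single)
    moreover have "w n \<le> (\<Sum>j\<in>UNIV. prob (upcrossing M X (u n) 1 j))" for n
      unfolding w_def using ev by (intro finite_measure_subadditive_finite) auto
    then have "exp (- (\<Sum>j\<in>UNIV. real n * prob (upcrossing M X (u n) 1 j))) \<le> exp (- (real n * w n))" for n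
      by (simp add: mult_left_mono flip: sum_distrib_left)
    ultimately have "exp (- (\<Sum>j\<in>UNIV. \<nu> $ j)) \<le> \<phi> \<nu>"
      by (intro LIMSEQ_le[OF _ \<phi>]) auto
    then show ?thesis by (rule less_le_trans[OF exp_gt_zero])
  qed
  have nw: "(\<lambda>n. real n * w n) \<longlonglongrightarrow> \<tau>"
    using tendsto_minus[OF tendsto_ln[OF \<phi>]] \<phi>_pos by (simp add: \<tau>_def)
  have \<tau>_pos: "0 < \<tau>"
  proof -
    \<comment> \<open>Any single component suffices, and there is one because types are
      inhabited.\<close>
    fix j
    have "prob (upcrossing M X (u n) 1 j) \<le> w n" for n
      unfolding w_def using any_upcrossing_sets[OF st] by (intro finite_measure_mono) auto
    then have "\<nu> $ j \<le> \<tau>"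
      by (intro LIMSEQ_le[OF single[of j] nw]) (auto intro!: exI[of _ 0] mult_left_mono)
    with \<nu> show ?thesis by (meson less_le_trans)
  qed
  have \<phi>_powr: "\<phi> \<nu> powr \<eta> \<nu> = exp (- (\<eta> \<nu> * \<tau>))"
    using \<phi>_pos by (simp add: powr_def \<tau>_def)

  \<comment> \<open>The gaps satisfy \<open>l n \<ge> 1\<close>, so the assumed limit for
    \<open>k n * l n / n\<close> dominates.\<close>
  have kn: "(\<lambda>n. real (k n) / real n) \<longlonglongrightarrow> 0"
  proof (rule tendsto_sandwich[OF _ _ tendsto_const kl])
    show "\<forall>\<^sub>F n in sequentially. real (k n) / real n \<le> real (k n) * real (l n) / real n"
      using eventually_ge_at_top[of 1]
    proof eventually_elim
      case (elim n)
      then have "real (k n) * 1 \<le> real (k n) * real (l n)"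
        using l_pos[of n] by (intro mult_left_mono) auto
      then show ?case by (intro divide_right_mono) auto
    qed
  qed auto
  have krn: "(\<lambda>n. real (k n * r n) / real n) \<longlonglongrightarrow> 1"
  proof (rule tendsto_sandwich)
    show "(\<lambda>n. 1 - real (k n) / real n) \<longlonglongrightarrow> 1"
      using tendsto_diff[OF tendsto_const[of 1] kn] by simp
    show "\<forall>\<^sub>F n in sequentially. 1 - real (k n) / real n \<le> real (k n * r n) / real n"
      using eventually_ge_at_top[of 1]
    proof eventually_elim
      case (elim n)
      then have "n mod k n < k n" using k_pos by simp
      moreover have "k n * r n + n mod k n = n" by (simp add: r_def)
      ultimately have "n \<le> k n * r n + k n" by linarith
      then have "real n - real (k n) \<le> real (k n * r n)" by linarith
      then have "(real n - real (k n)) / real n \<le> real (k n * r n) / real n"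
        by (rule divide_right_mono) simp
      then show ?case using elim by (simp add: diff_divide_distrib)
    qed
    show "\<forall>\<^sub>F n in sequentially. real (k n * r n) / real n \<le> 1"
      by (intro always_eventually allI) (auto simp: r_def divide_le_eq_1 simp flip: of_nat_mult)
  qed simp
  have krw: "(\<lambda>n. real (k n * r n) * w n) \<longlonglongrightarrow> \<tau>"
  proof -
    have "(\<lambda>n. real (k n * r n) / real n * (real n * w n)) \<longlonglongrightarrow> 1 * \<tau>"
      by (intro tendsto_mult krn nw)
    \<comment> \<open>At \<open>n = 0\<close>, where \<open>n\<close> cannot be cancelled, both
      sides vanish since \<open>r 0 = 0\<close>.\<close>
    moreover have "real (k n * r n) / real n * (real n * w n) = real (k n * r n) * w n" for n
      by (cases "n = 0") (simp_all add: r_def)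
    ultimately show ?thesis by simp
  qed

  have "(\<lambda>n. prob (no_upcrossing M X (u n) 0 n) - (1 - q n) ^ k n) \<longlonglongrightarrow> 0"
  proof (rule Lim_null_comparison)
    have "(\<lambda>n. \<bar>real (k n) * mixing_coeff M X u n (l n)\<bar>
        + (2 * (real (k n) * real (l n) / real n) + real (k n) / real n) * (real n * w n))
        \<longlonglongrightarrow> \<bar>0\<bar> + (2 * 0 + 0) * \<tau>"
      by (intro tendsto_intros k\<alpha> kl kn nw)
    then show "(\<lambda>n. \<bar>real (k n) * mixing_coeff M X u n (l n)\<bar>
        + (2 * (real (k n) * real (l n) / real n) + real (k n) / real n) * (real n * w n)) \<longlonglongrightarrow> 0"
      by simp
    \<comment> \<open>Eventually \<open>k n * l n \<le> n\<close>, as the block approximation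
      requires.\<close>
    have "\<forall>\<^sub>F n in sequentially. real (k n) * real (l n) / real n < 1"
      using kl by (rule order_tendstoD) simp
    then show "\<forall>\<^sub>F n in sequentially. norm (prob (no_upcrossing M X (u n) 0 n) - (1 - q n) ^ k n)
        \<le> \<bar>real (k n) * mixing_coeff M X u n (l n)\<bar>
          + (2 * (real (k n) * real (l n) / real n) + real (k n) / real n) * (real n * w n)"
      using eventually_ge_at_top[of 1]
    proof eventually_elim
      case (elim n)
      have "real (k n * l n) < real n" using elim by (simp add: field_simps)
      then have "k n * l n \<le> n" by linarith
      then have "\<bar>prob (no_upcrossing M X (u n) 0 n) - prob (no_upcrossing M X (u n) 0 (r n)) ^ k n\<bar>
          \<le> real (k n) * \<bar>mixing_coeff M X u n (l n)\<bar> + real (2 * k n * l n + k n) * w n"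
        unfolding w_def using elim k_pos l_pos
        by (intro no_upcrossing_block_approx[OF st]) (auto simp: r_def)
      \<comment> \<open>Extending by \<open>n\<close> pairs the convergent \<open>n * w n\<close>
        with factors that tend to 0.\<close>
      also have "real (2 * k n * l n + k n) * w n
          = (2 * (real (k n) * real (l n) / real n) + real (k n) / real n) * (real n * w n)"
        using elim by (simp add: field_simps)
      finally show ?case by (simp add: q_def abs_mult)
    qed
  qed
  from tendsto_diff[OF clear this]
  have power_lim: "(\<lambda>n. (1 - q n) ^ k n) \<longlonglongrightarrow> exp (- (\<eta> \<nu> * \<tau>))"
    by (simp add: \<phi>_powr)

  have q0: "q \<longlonglongrightarrow> 0"
  proof (rule Lim_null_comparison)
    \<comment> \<open>The union bound gives \<open>q n \<le> r n * w n\<close>; written as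
      \<open>k n * r n * w n\<close> over \<open>k n\<close>, this is a convergent sequence divided
      by one that tends to infinity.\<close>
    have "(\<lambda>n. real (k n * r n) * w n * (1 / real (k n))) \<longlonglongrightarrow> \<tau> * 0"
      by (intro tendsto_mult krw lim_const_over_n[THEN filterlim_compose] k_top)
    then show "(\<lambda>n. real (k n * r n) * w n * (1 / real (k n))) \<longlonglongrightarrow> 0" by simp
    show "\<forall>\<^sub>F n in sequentially. norm (q n) \<le> real (k n * r n) * w n * (1 / real (k n))"
      using eventually_ge_at_top[of 1]
    proof eventually_elim
      case (elim n)
      have "\<bar>prob (no_upcrossing M X (u n) 0 (r n)) - prob (space M)\<bar> \<le> real (card {1..r n}) * w n"
        unfolding w_def
        by (rule prob_diff_le_upcrossings[OF st _ _ no_upcrossing_sets[OF st]])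
          (auto simp: no_upcrossing_def)
      then have "norm (q n) \<le> real (r n) * w n" by (simp add: q_def prob_space abs_minus_commute)
      moreover have "k n \<noteq> 0" using elim k_pos by force
      ultimately show ?case by simp
    qed
  qed
  have kq: "(\<lambda>n. real (k n) * q n) \<longlonglongrightarrow> \<eta> \<nu> * \<tau>"
    by (rule tendsto_mult_one_minus_of_power[OF power_lim q0])
  have \<eta>_pos: "0 < \<eta> \<nu>" using assms(6) \<nu> by blast
  \<comment> \<open>The mean cluster size \<open>r n * w n / q n\<close> is extended by
    \<open>k n\<close>, so that numerator and denominator have positive finite limits.\<close>
  have "(\<lambda>n. real (k n * r n) * w n / (real (k n) * q n)) \<longlonglongrightarrow> \<tau> / (\<eta> \<nu> * \<tau>)"
    using \<eta>_pos \<tau>_pos by (intro tendsto_divide krw kq) auto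
  then have lim: "(\<lambda>n. real (k n * r n) * w n / (real (k n) * q n)) \<longlonglongrightarrow> 1 / \<eta> \<nu>"
    using \<tau>_pos by simp
  show "(\<lambda>n. \<Sum>\<^sub>\<infinity>m\<in>{1..}. real m * cluster_prob M X u (\<lambda>n. n div k n) n m) \<longlonglongrightarrow> 1 / \<eta> \<nu>"
  proof (rule Lim_transform_eventually[OF lim])
    show "\<forall>\<^sub>F n in sequentially. real (k n * r n) * w n / (real (k n) * q n)
        = (\<Sum>\<^sub>\<infinity>m\<in>{1..}. real m * cluster_prob M X u (\<lambda>n. n div k n) n m)"
      using eventually_ge_at_top[of 1]
    proof eventually_elim
      case (elim n)
      then have "k n \<noteq> 0" using k_pos by force
      then have "real (k n * r n) * w n / (real (k n) * q n) = real (r n) * w n / q n"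
        by simp
      then show ?case
        unfolding mean_cluster_size[OF st] by (simp add: w_def q_def r_def)
    qed
  qed
qed

end
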